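(* Let $(X,V,W,S,\mathcal H_*,*,\Theta)$, together with the polarization $(u,H)\mapsto u^H$, satisfy the abstract symmetrization framework described in the context. Let $h:[0,+\infty)\to[0,+\infty)$ be a nondecreasing continuous function such that $\int_0^{+\infty}\frac{1}{1+h(s)}\,ds=+\infty$. Assume that, for $\rho_0>0$ sufficiently small, there exists a function $r:[0,\rho_0)\to[0,\infty)$ with $$\int_0^{r(\rho)}\frac{1}{1+h(s)}\,ds\ge\rho,\qquad \lim_{\rho\to0^+}r(\rho)=0 .$$ Let $f:X\to\mathbb R\cup\{+\infty\}$ be a proper lower semi-continuous functional bounded from below such that $f(u^H)\le f(u)$ for all $u\in S$ and $H\in\mathcal H_*$. Let $u\in S$, $\rho\in(0,\rho_0)$ and $\sigma>0$ be such that $f(u)<\inf_X f+\sigma\rho$. Then there exists $v\in X$ such that: (a) $\|v-v^*\|_V<(K(C_\Theta+1)+1)\,r(\rho)$; (b) $f(v)\le f(u)$; (c) $\|v-u\|\le r(\rho)+\|\mathbb T_{r(\rho)}u-u\|$; (d) $f(w)\ge f(v)-\sigma\dfrac{\|w-v\|}{1+h(\|v-\mathbb T_{r(\rho)}u\|)}$ for every $w\in X$.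
   Context: Abstract framework. $X,V,W$ are real Banach spaces with $X\subseteq V\subseteq W$, $X$ continuously embedded in $V$ and $V$ continuously embedded in $W$; $\|\cdot\|$ is the norm of $X$ and $K>0$ is a continuity constant of $X\hookrightarrow V$, i.e. $\|u\|_V\le K\|u\|$ for $u\in X$. $S\subseteq X$ carries the metric induced by $\|\cdot\|$, $\mathcal H_*$ is a path-connected topological space, and there are maps $*:S\to S$, $u\mapsto u^*$ (symmetrization) and $S\times\mathcal H_*\to S$, $(u,H)\mapsto u^H$ (polarization) such that: the polarization map is continuous; $(u^* )^H=(u^H)^*=u^*$ and $(u^H)^H=u^H$ for all $u\in S$, $H\in\mathcal H_*$; there is a sequence $(H_m)\subset\mathcal H_*$ such that for every $u\in S$ the iterated polarizations $u^{H_1\cdots H_m}$ converge to $u^*$ in $V$ as $m\to\infty$; $\|u^H-v^H\|_V\le\|u-v\|_V$ for all $u,v\in S$, $H\in\mathcal H_*$. Moreover $\Theta:(X,\|\cdot\|_V)\to(S,\|\cdot\|_V)$ is Lipschitz with constant $C_\Theta>0$ and $\Theta|_S=\mathrm{Id}|_S$; for $u\in X$ one sets $u^H:=(\Theta(u))^H$ and $u^*:=(\Theta(u))^*$. For every $\rho>0$, $\mathbb T_\rho:S\to S$ denotes a continuous map such that, for every $u\in S$, $\mathbb T_\rho u$ is obtained from $u$ by finitely many iterated polarizations by elements of $\mathcal H_*$, and $\|\mathbb T_\rho u-u^*\|_V<\rho$ (such maps are known to exist in this framework). Proper means not identically $+\infty$. *)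

theory Defs
  imports "HOL-Analysis.Analysis"
begin

(* The iterated polarization u^{H_1 ... H_m} = (...(u^{H_1})...)^{H_m}. *)
definition iterated_polarization :: "('x \<Rightarrow> 'h \<Rightarrow> 'x) \<Rightarrow> 'x \<Rightarrow> 'h list \<Rightarrow> 'x" where
  "iterated_polarization pol u Hs = foldl pol u Hs"

(* The inclusions of X in V and of V in W are injective bounded linear maps i and j, so the
   V-norm of u - v, for u and v in X, is norm (i u - i v).
   The functions star and pol are only meaningful on S and on S \<times> \<H>; the extensions to all of X
   go through \<Theta>. *)
locale symmetrization_framework =
  fixes i :: "'x::banach \<Rightarrow> 'v::banach"
    and j :: "'v \<Rightarrow> 'w::banach"
    and K :: real
    and S :: "'x set"
    and \<H> :: "'h::topological_space set"
    and star :: "'x \<Rightarrow> 'x"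
    and pol :: "'x \<Rightarrow> 'h \<Rightarrow> 'x"
    and \<Theta> :: "'x \<Rightarrow> 'x"
    and C\<^sub>\<Theta> :: real
  assumes embedding_XV: "bounded_linear i" "inj i"
    and embedding_VW: "bounded_linear j" "inj j"
    and K_pos: "K > 0"
    and K_bound: "\<And>u. norm (i u) \<le> K * norm u"
    and path_connected_H: "path_connected \<H>"
    and star_in: "\<And>u. u \<in> S \<Longrightarrow> star u \<in> S"
    and pol_in: "\<And>u H. u \<in> S \<Longrightarrow> H \<in> \<H> \<Longrightarrow> pol u H \<in> S"
    and pol_continuous: "continuous_on (S \<times> \<H>) (\<lambda>(u, H). pol u H)"
    and pol_star: "\<And>u H. u \<in> S \<Longrightarrow> H \<in> \<H> \<Longrightarrow> pol (star u) H = star u"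
    and star_pol: "\<And>u H. u \<in> S \<Longrightarrow> H \<in> \<H> \<Longrightarrow> star (pol u H) = star u"
    and pol_idem: "\<And>u H. u \<in> S \<Longrightarrow> H \<in> \<H> \<Longrightarrow> pol (pol u H) H = pol u H"
    and pol_approx: "\<exists>Hseq :: nat \<Rightarrow> 'h. range Hseq \<subseteq> \<H> \<and>
          (\<forall>u\<in>S. (\<lambda>m. i (iterated_polarization pol u (map Hseq [0..<m]))) \<longlonglongrightarrow> i (star u))"
    and pol_nonexpansive:
          "\<And>u v H. u \<in> S \<Longrightarrow> v \<in> S \<Longrightarrow> H \<in> \<H> \<Longrightarrow>
             norm (i (pol u H) - i (pol v H)) \<le> norm (i u - i v)"
    and Theta_in: "\<And>u. \<Theta> u \<in> S"
    and C_Theta_pos: "C\<^sub>\<Theta> > 0"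
    and Theta_lipschitz: "\<And>u v. norm (i (\<Theta> u) - i (\<Theta> v)) \<le> C\<^sub>\<Theta> * norm (i u - i v)"
    and Theta_id: "\<And>u. u \<in> S \<Longrightarrow> \<Theta> u = u"

(* u^* for arbitrary u in X. *)
definition star_ext :: "('x \<Rightarrow> 'x) \<Rightarrow> ('x \<Rightarrow> 'x) \<Rightarrow> 'x \<Rightarrow> 'x" where
  "star_ext \<Theta> star u = star (\<Theta> u)"

(* The list of polarizations producing T \<rho> u may depend on u as well as on \<rho>. *)
definition approximating_maps ::
  "('x::real_normed_vector \<Rightarrow> 'v::real_normed_vector) \<Rightarrow> 'x set \<Rightarrow> 'h set \<Rightarrow> ('x \<Rightarrow> 'x)
     \<Rightarrow> ('x \<Rightarrow> 'h \<Rightarrow> 'x) \<Rightarrow> (real \<Rightarrow> 'x \<Rightarrow> 'x) \<Rightarrow> bool" where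
  "approximating_maps i S \<H> star pol T \<longleftrightarrow>
     (\<forall>\<rho>>0. T \<rho> ` S \<subseteq> S \<and> continuous_on S (T \<rho>) \<and>
        (\<forall>u\<in>S. (\<exists>Hs. set Hs \<subseteq> \<H> \<and> T \<rho> u = iterated_polarization pol u Hs) \<and>
               norm (i (T \<rho> u) - i (star u)) < \<rho>))"

definition lower_semicontinuous :: "('a::topological_space \<Rightarrow> ereal) \<Rightarrow> bool" where
  "lower_semicontinuous f \<longleftrightarrow> (\<forall>x. f x \<le> Liminf (at x) f)"

end

(*
The core is Zhong's variational principle, applied to f at the base point y = T u (with T the
approximating map for the radius R = r(rho)): it yields v within R of y with f v <= f y <= f u
and property (d). Its proof runs the Ekeland iteration with the weight g(s) = 1 / (1 + h s)
evaluated at the distance from the current point to y. Since g is nonincreasing, the total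
weighted length of the orbit dominates the integral of g from 0 to the distance reached, which
keeps the orbit in the ball of radius R, where g is bounded below.
For (a), star is nonexpansive in V as a limit of nonexpansive maps and star y = star u, so
|v - v*| <= |v - y| + |y - u*| + |y* - v*| with the middle term below R.
*)
theory Submission
  imports Defs
begin

section \<open>Polarization and symmetrization in the norm of V\<close>

lemma (in symmetrization_framework) iterated_polarization_in:
  assumes "u \<in> S" "set Hs \<subseteq> \<H>"
  shows "iterated_polarization pol u Hs \<in> S"
  using assms unfolding iterated_polarization_def
  by (induction Hs arbitrary: u) (auto simp: pol_in)

lemma (in symmetrization_framework) star_iterated_polarization:
  assumes "u \<in> S" "set Hs \<subseteq> \<H>"
  shows "star (iterated_polarization pol u Hs) = star u"
  using assms unfolding iterated_polarization_def
  by (induction Hs arbitrary: u) (auto simp: pol_in star_pol)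

lemma (in symmetrization_framework) iterated_polarization_nonexpansive:
  assumes "u \<in> S" "v \<in> S" "set Hs \<subseteq> \<H>"
  shows "norm (i (iterated_polarization pol u Hs) - i (iterated_polarization pol v Hs))
           \<le> norm (i u - i v)"
  using assms unfolding iterated_polarization_def
proof (induction Hs arbitrary: u v)
  case (Cons H Hs)
  then have "norm (i (foldl pol (pol u H) Hs) - i (foldl pol (pol v H) Hs))
      \<le> norm (i (pol u H) - i (pol v H))"
    by (auto simp: pol_in)
  also have "\<dots> \<le> norm (i u - i v)"
    using Cons.prems by (auto intro: pol_nonexpansive)
  finally show ?case by simp
qed simp

text \<open>A single sequence of polarizations approximates \<open>star\<close> at every point of S.
  The same iterates can therefore be applied to \<open>u\<close> and \<open>v\<close>, and the
  nonexpansiveness of each iterate passes to the limit.\<close>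

lemma (in symmetrization_framework) star_nonexpansive:
  assumes "u \<in> S" "v \<in> S"
  shows "norm (i (star u) - i (star v)) \<le> norm (i u - i v)"
proof -
  obtain Hseq :: "nat \<Rightarrow> 'h" where H: "range Hseq \<subseteq> \<H>"
    and lim: "\<And>u. u \<in> S \<Longrightarrow>
      (\<lambda>m. i (iterated_polarization pol u (map Hseq [0..<m]))) \<longlonglongrightarrow> i (star u)"
    using pol_approx by blast
  have "(\<lambda>m. norm (i (iterated_polarization pol u (map Hseq [0..<m]))
           - i (iterated_polarization pol v (map Hseq [0..<m]))))
         \<longlonglongrightarrow> norm (i (star u) - i (star v))"
    by (intro tendsto_norm tendsto_diff lim assms)
  then show ?thesis
  proof (rule LIMSEQ_le_const2)
    have "set (map Hseq [0..<n]) \<subseteq> \<H>" for n using H by auto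
    then show "\<exists>N. \<forall>n\<ge>N. norm (i (iterated_polarization pol u (map Hseq [0..<n]))
        - i (iterated_polarization pol v (map Hseq [0..<n]))) \<le> norm (i u - i v)"
      using assms by (blast intro: iterated_polarization_nonexpansive)
  qed
qed

text \<open>The three parts of the constant are K R for moving from \<open>v\<close> to the
  polarized point, R for its distance to \<open>star u\<close>, and \<open>C\<^sub>\<Theta>\<close>
  K R for comparing the symmetrizations. The point \<open>v\<close> may lie outside S, so the last
  part passes through \<Theta>, which fixes the polarized point. Strictness comes from
  \<open>close\<close>.\<close>

lemma (in symmetrization_framework) star_ext_approximation:
  assumes u: "u \<in> S" and Hs: "set Hs \<subseteq> \<H>"
    and close: "norm (i (iterated_polarization pol u Hs) - i (star u)) < R"
    and v: "norm (v - iterated_polarization pol u Hs) \<le> R"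
  shows "norm (i v - i (star_ext \<Theta> star v)) < (K * (C\<^sub>\<Theta> + 1) + 1) * R"
proof -
  define y where "y = iterated_polarization pol u Hs"
  have y: "y \<in> S" "star y = star u"
    unfolding y_def by (simp_all add: u Hs iterated_polarization_in star_iterated_polarization)
  have "norm (i (v - y)) \<le> K * norm (v - y)"
    by (rule K_bound)
  also have "\<dots> \<le> K * R"
    using v K_pos by (simp add: y_def)
  finally have vy: "norm (i v - i y) \<le> K * R"
    by (simp add: linear_diff[OF bounded_linear.linear[OF embedding_XV(1)]])
  have "norm (i (star y) - i (star (\<Theta> v))) \<le> norm (i y - i (\<Theta> v))"
    by (intro star_nonexpansive y Theta_in)
  also have "\<dots> \<le> C\<^sub>\<Theta> * norm (i y - i v)"
    using Theta_lipschitz[of y v] y by (simp add: Theta_id)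
  also have "\<dots> \<le> C\<^sub>\<Theta> * (K * R)"
    using vy C_Theta_pos by (simp add: norm_minus_commute)
  finally have stars: "norm (i (star y) - i (star (\<Theta> v))) \<le> C\<^sub>\<Theta> * (K * R)" .
  have "norm (i v - i (star (\<Theta> v)))
      \<le> norm (i v - i y) + norm (i y - i (star y)) + norm (i (star y) - i (star (\<Theta> v)))"
    by norm
  also have "\<dots> < K * R + R + C\<^sub>\<Theta> * (K * R)"
    using vy stars close y by (simp add: y_def)
  also have "\<dots> = (K * (C\<^sub>\<Theta> + 1) + 1) * R"
    by (simp add: algebra_simps)
  finally show ?thesis
    by (simp add: star_ext_def)
qed

lemma iterated_polarization_decreasing:
  fixes f :: "'x \<Rightarrow> ereal"
  assumes pol_in: "\<And>u H. u \<in> S \<Longrightarrow> H \<in> \<H> \<Longrightarrow> pol u H \<in> S"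
    and f_pol: "\<forall>z\<in>S. \<forall>H\<in>\<H>. f (pol z H) \<le> f z"
    and "u \<in> S" "set Hs \<subseteq> \<H>"
  shows "f (iterated_polarization pol u Hs) \<le> f u"
  using assms(3,4) unfolding iterated_polarization_def
proof (induction Hs arbitrary: u)
  case (Cons H Hs)
  then have "f (foldl pol (pol u H) Hs) \<le> f (pol u H)"
    by (simp add: pol_in)
  also have "\<dots> \<le> f u"
    using Cons.prems f_pol by simp
  finally show ?case by simp
qed simp

section \<open>Semicontinuity, integrals of decreasing weights, and sequences of finite
  length\<close>

lemma lower_semicontinuous_decreasing_limit:
  fixes f :: "'a::topological_space \<Rightarrow> ereal"
  assumes lsc: "lower_semicontinuous f" and lim: "X \<longlonglongrightarrow> v"
    and dec: "decseq (\<lambda>n. f (X n))"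
  shows "f v \<le> f (X m)"
proof (rule ccontr)
  assume "\<not> f v \<le> f (X m)"
  then have less: "f (X m) < f v" by simp
  have "\<forall>\<^sub>F x in at v. f (X m) < f x"
    using lsc less unfolding lower_semicontinuous_def le_Liminf_iff by blast
  \<comment> \<open>The sequence may hit \<open>v\<close> itself, so the punctured filter is not
    enough; \<open>less\<close> supplies the missing point.\<close>
  then have "\<forall>\<^sub>F x in nhds v. f (X m) < f x"
    using less by (auto simp: eventually_at_filter elim!: eventually_mono)
  then have "\<forall>\<^sub>F n in sequentially. f (X m) < f (X n)"
    by (rule eventually_compose_filterlim[OF _ lim])
  then obtain N where "\<And>n. n \<ge> N \<Longrightarrow> f (X m) < f (X n)"
    unfolding eventually_sequentially by blast
  then have "f (X m) < f (X (max N m))" by simp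
  moreover have "f (X (max N m)) \<le> f (X m)"
    using decseqD[OF dec] by simp
  ultimately show False by simp
qed

text \<open>To the right of \<open>a\<close> the integrand is at most \<open>g a\<close>; to the
  left, the integral only shrinks. The absolute value covers both cases, since an orbit may also
  move back towards its base point.\<close>

lemma antimono_integral_le:
  fixes g :: "real \<Rightarrow> real"
  assumes cont: "continuous_on {0..} g" and anti: "antimono_on {0..} g"
    and nonneg: "\<And>s. s \<ge> 0 \<Longrightarrow> g s \<ge> 0" and ab: "a \<ge> 0" "b \<ge> 0"
  shows "integral {0..b} g \<le> integral {0..a} g + g a * \<bar>b - a\<bar>"
proof -
  have int: "g integrable_on {s..t}" if "s \<ge> 0" for s t
    by (intro integrable_continuous_interval continuous_on_subset[OF cont]) (use that in auto)
  show ?thesis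
  proof (cases "a \<le> b")
    case True
    have "integral {0..b} g = integral {0..a} g + integral {a..b} g"
      using Henstock_Kurzweil_Integration.integral_combine[of 0 a b g] True ab int by simp
    also have "integral {a..b} g \<le> integral {a..b} (\<lambda>_. g a)"
      by (rule integral_le) (use int ab anti in \<open>auto simp: monotone_on_def\<close>)
    finally show ?thesis using True by (simp add: mult.commute)
  next
    case False
    have "integral {0..a} g = integral {0..b} g + integral {b..a} g"
      using Henstock_Kurzweil_Integration.integral_combine[of 0 b a g] False ab int by simp
    moreover have "integral {b..a} g \<ge> 0"
      by (rule integral_nonneg) (use int ab nonneg in auto)
    moreover have "g a * \<bar>b - a\<bar> \<ge> 0" using nonneg ab by simp
    ultimately show ?thesis by simp
  qed
qed

text \<open>By the reverse triangle inequality a step changes the distance to \<open>X 0\<close> by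
  at most its own length. Weighting it at its starting point thus pays for the increase of the
  integral.\<close>

lemma weighted_length_bound:
  fixes X :: "nat \<Rightarrow> 'a::metric_space"
  assumes cont: "continuous_on {0..} g" and anti: "antimono_on {0..} g"
    and nonneg: "\<And>s. s \<ge> 0 \<Longrightarrow> g s \<ge> 0"
  shows "integral {0..dist (X n) (X 0)} g
           \<le> (\<Sum>k<n. g (dist (X k) (X 0)) * dist (X (Suc k)) (X k))"
proof (induction n)
  case (Suc n)
  let ?t = "\<lambda>k. dist (X k) (X 0)"
  have "integral {0..?t (Suc n)} g \<le> integral {0..?t n} g + g (?t n) * \<bar>?t (Suc n) - ?t n\<bar>"
    by (rule antimono_integral_le[OF cont anti nonneg]) auto
  also have "g (?t n) * \<bar>?t (Suc n) - ?t n\<bar> \<le> g (?t n) * dist (X (Suc n)) (X n)"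
    using abs_dist_diff_le[of "X (Suc n)" "X 0" "X n"]
    by (intro mult_left_mono nonneg) (simp_all add: dist_commute)
  finally show ?case using Suc by simp
qed simp

lemma ex_near_minimizer:
  fixes F :: "'a \<Rightarrow> real"
  assumes "A \<noteq> {}" "bdd_below (F ` A)" "e > 0"
  shows "\<exists>x\<in>A. \<forall>w\<in>A. F x \<le> F w + e"
proof -
  have "Inf (F ` A) < Inf (F ` A) + e" using assms by simp
  then obtain x where x: "x \<in> A" "F x < Inf (F ` A) + e"
    using assms cInf_lessD[of "F ` A" "Inf (F ` A) + e"] by auto
  moreover have "Inf (F ` A) \<le> F w" if "w \<in> A" for w
    using that assms by (auto intro: cInf_lower)
  ultimately show ?thesis by force
qed

lemma summable_dist_Cauchy:
  fixes X :: "nat \<Rightarrow> 'a::metric_space"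
  assumes "summable (\<lambda>n. dist (X (Suc n)) (X n))"
  shows "Cauchy X"
proof (rule metric_CauchyI)
  \<comment> \<open>The partial lengths form a real Cauchy sequence that controls all distances
    along \<open>X\<close>.\<close>
  define s where "s = (\<lambda>n. \<Sum>k<n. dist (X (Suc k)) (X k))"
  have ordered: "dist (X m) (X n) \<le> s n - s m" if "m \<le> n" for m n
    using that
  proof (induction rule: dec_induct)
    case (step n)
    then show ?case
      using dist_triangle[of "X m" "X (Suc n)" "X n"] by (simp add: s_def dist_commute)
  qed simp
  have bound: "dist (X m) (X n) \<le> dist (s m) (s n)" for m n
  proof (cases "m \<le> n")
    case True
    then show ?thesis using ordered[of m n] by (simp add: dist_real_def)
  next
    case False
    then show ?thesis using ordered[of n m] by (simp add: dist_real_def dist_commute)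
  qed
  have "Cauchy s"
    using assms by (simp add: s_def summable_iff_convergent convergent_Cauchy)
  then show "\<exists>M. \<forall>m\<ge>M. \<forall>n\<ge>M. dist (X m) (X n) < e" if "e > 0" for e
    using that bound unfolding Cauchy_def by (meson le_less_trans)
qed

section \<open>Zhong's variational principle, which for h = 0 is Ekeland's\<close>

theorem Zhong_variational_principle:
  fixes f :: "'a::complete_space \<Rightarrow> ereal" and h :: "real \<Rightarrow> real"
  assumes h_nonneg: "\<forall>s\<ge>0. h s \<ge> 0" and h_mono: "mono_on {0..} h"
    and h_cont: "continuous_on {0..} h"
    and r_nonneg: "R \<ge> 0"
    and r_int: "integral {0..R} (\<lambda>s. 1 / (1 + h s)) \<ge> \<rho>"
    and f_lsc: "lower_semicontinuous f"
    and f_bdd_below: "\<And>x. ereal m \<le> f x"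
    and sigma: "\<sigma> > 0"
    and f_y: "f y < (INF x. f x) + ereal (\<sigma> * \<rho>)"
  obtains v where "dist v y \<le> R" "f v \<le> f y"
    "\<And>w. f w \<ge> f v - ereal (\<sigma> * (dist w v / (1 + h (dist v y))))"
proof -
  define g where "g = (\<lambda>s. 1 / (1 + h s))"
  have g_cont: "continuous_on {0..} g"
    unfolding g_def by (intro continuous_intros h_cont) (use h_nonneg in \<open>force\<close>)
  have g_pos: "g s > 0" if "s \<ge> 0" for s
    using h_nonneg[rule_format, OF that] by (simp add: g_def)
  have g_anti: "antimono_on {0..} g"
  proof (rule monotone_onI)
    fix s t :: real
    assume st: "s \<in> {0..}" "t \<in> {0..}" "s \<le> t"
    then have "h s \<le> h t" by (rule mono_onD[OF h_mono])
    moreover have "0 \<le> h s" using h_nonneg st by simp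
    ultimately show "g t \<le> g s" by (simp add: g_def frac_le)
  qed
  define D where "D = {x. f x < \<infinity>}"
  \<comment> \<open>Outside \<open>D\<close> this takes the default value 0, so every use of
    \<open>F\<close> is guarded by membership in \<open>D\<close>.\<close>
  define F where "F = (\<lambda>x. real_of_ereal (f x))"
  have F: "f x = ereal (F x)" if "x \<in> D" for x
    using that f_bdd_below[of x] by (cases "f x") (auto simp: D_def F_def)
  have y: "y \<in> D" using f_y by (auto simp: D_def)
  have F_bdd: "m \<le> F x" if "x \<in> D" for x
    using f_bdd_below[of x] F[OF that] by simp
  have gap: "F y - F x < \<sigma> * \<rho>" if "x \<in> D" for x
  proof -
    have "f y < f x + ereal (\<sigma> * \<rho>)"
      using f_y by (rule less_le_trans) (intro add_mono INF_lower order_refl UNIV_I)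
    then show ?thesis using F[OF that] F[OF y] by simp
  qed
  \<comment> \<open>The weight is frozen at the current point, so the relation need not be
    transitive and the sets along the orbit need not be nested. Convergence is therefore obtained
    from finite length rather than from shrinking sets.\<close>
  define A where "A = (\<lambda>x. {w \<in> D. F w + \<sigma> * (g (dist x y) * dist w x) \<le> F x})"
  have step: "\<exists>x'. x' \<in> D \<and> x' \<in> A x \<and> (\<forall>w\<in>A x. F x' \<le> F w + 1 / real (Suc n))"
    if "x \<in> D" for x n
  proof -
    have "x \<in> A x" using that by (simp add: A_def)
    moreover have "bdd_below (F ` A x)"
      using F_bdd by (intro bdd_belowI[of _ m]) (auto simp: A_def)
    ultimately have "\<exists>x'\<in>A x. \<forall>w\<in>A x. F x' \<le> F w + 1 / real (Suc n)"
      by (intro ex_near_minimizer) auto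
    then show ?thesis by (auto simp: A_def)
  qed
  \<comment> \<open>The clause for n = 0 fixes the starting point. The tolerance 1 / (n + 1)
    vanishes in the limit, which the final contradiction needs.\<close>
  have "\<exists>X. \<forall>n. (X n \<in> D \<and> (n = 0 \<longrightarrow> X n = y)) \<and>
      (X (Suc n) \<in> A (X n) \<and> (\<forall>w\<in>A (X n). F (X (Suc n)) \<le> F w + 1 / real (Suc n)))"
    by (rule dependent_nat_choice) (use y step in auto)
  then obtain X where X: "\<And>n. X n \<in> D" "X 0 = y" "\<And>n. X (Suc n) \<in> A (X n)"
    and near_min: "\<And>n w. w \<in> A (X n) \<Longrightarrow> F (X (Suc n)) \<le> F w + 1 / real (Suc n)"
    by blast
  have descent: "\<sigma> * (g (dist (X n) y) * dist (X (Suc n)) (X n)) \<le> F (X n) - F (X (Suc n))" for n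
    using X(3)[of n] by (simp add: A_def)
  have total: "\<sigma> * (\<Sum>k<n. g (dist (X k) y) * dist (X (Suc k)) (X k)) \<le> F y - F (X n)" for n
  proof (induction n)
    case (Suc n)
    then show ?case using descent[of n] by (simp add: distrib_left)
  qed (simp add: X(2))
  \<comment> \<open>By \<open>r_int\<close>, leaving the ball costs a weighted length of at least
    \<rho>, hence a drop of F by at least \<sigma> \<rho>; \<open>gap\<close> leaves less than that
    to spend.\<close>
  have in_ball: "dist (X n) y \<le> R" for n
  proof (rule ccontr)
    assume "\<not> dist (X n) y \<le> R"
    then have "integral {0..R} g \<le> integral {0..dist (X n) y} g"
      by (intro integral_subset_le integrable_continuous_interval continuous_on_subset[OF g_cont])
        (use g_pos in \<open>auto intro: less_imp_le\<close>)
    also have "\<dots> \<le> (\<Sum>k<n. g (dist (X k) y) * dist (X (Suc k)) (X k))"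
      using weighted_length_bound[OF g_cont g_anti, of X n] X(2) g_pos by (simp add: less_imp_le)
    finally have "\<sigma> * \<rho> \<le> \<sigma> * (\<Sum>k<n. g (dist (X k) y) * dist (X (Suc k)) (X k))"
      using r_int sigma by (simp add: g_def)
    then show False
      using total[of n] gap[OF X(1)[of n]] by linarith
  qed
  have "summable (\<lambda>n. dist (X (Suc n)) (X n))"
  proof (rule summableI_nonneg_bounded)
    fix n
    \<comment> \<open>Inside the ball every weight is at least \<open>g R\<close>, so the bound on
      weighted length becomes one on plain length.\<close>
    have "\<sigma> * (g R * (\<Sum>k<n. dist (X (Suc k)) (X k)))
        \<le> \<sigma> * (\<Sum>k<n. g (dist (X k) y) * dist (X (Suc k)) (X k))"
      unfolding sum_distrib_left[of "g R"]
      using g_anti in_ball sigma r_nonneg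
      by (intro mult_left_mono sum_mono mult_right_mono) (auto simp: monotone_on_def)
    also have "\<dots> \<le> \<sigma> * \<rho>"
      using total[of n] gap[OF X(1)[of n]] by linarith
    finally show "(\<Sum>k<n. dist (X (Suc k)) (X k)) \<le> \<rho> / g R"
      using sigma g_pos[OF r_nonneg] by (simp add: field_simps)
  qed simp
  then have "Cauchy X"
    by (rule summable_dist_Cauchy)
  then obtain v where v: "X \<longlonglongrightarrow> v"
    by (auto simp: Cauchy_convergent_iff convergent_def)
  have dec: "decseq (\<lambda>n. f (X n))"
  proof (rule decseq_SucI)
    fix n
    have "0 \<le> \<sigma> * (g (dist (X n) y) * dist (X (Suc n)) (X n))"
      using sigma g_pos[of "dist (X n) y"] by simp
    then show "f (X (Suc n)) \<le> f (X n)"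
      using descent[of n] F X(1) by simp
  qed
  have fv: "f v \<le> f (X n)" for n
    by (rule lower_semicontinuous_decreasing_limit[OF f_lsc v dec])
  have vD: "v \<in> D"
    using fv[of 0] y X(2) by (auto simp: D_def)
  have Fv: "F v \<le> F (X n)" for n
    using fv[of n] F vD X(1) by simp
  have dist_lim: "(\<lambda>n. dist (X n) y) \<longlonglongrightarrow> dist v y"
    by (intro tendsto_intros v)
  have "dist v y \<le> R"
    by (rule LIMSEQ_le_const2[OF dist_lim]) (use in_ball in auto)
  moreover have "f v \<le> f y" using fv[of 0] X(2) by simp
  moreover have "f w \<ge> f v - ereal (\<sigma> * (dist w v / (1 + h (dist v y))))" for w
  proof (cases "w \<in> D")
    case w: True
    \<comment> \<open>If this fails, the strict inequality at \<open>v\<close> persists along the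
      tail of the orbit, so \<open>w\<close> eventually competes in \<open>A (X n)\<close>.
      Near-minimality of the next point then forces F v \<le> F w in the limit, contrary to the
      assumed strict drop.\<close>
    have "F w \<ge> F v - \<sigma> * (g (dist v y) * dist w v)"
    proof (rule ccontr)
      assume "\<not> ?thesis"
      then have less: "F w + \<sigma> * (g (dist v y) * dist w v) < F v" by simp
      have "(\<lambda>n. g (dist (X n) y)) \<longlonglongrightarrow> g (dist v y)"
        by (rule continuous_on_tendsto_compose[OF g_cont dist_lim]) auto
      then have "(\<lambda>n. F w + \<sigma> * (g (dist (X n) y) * dist w (X n)))
          \<longlonglongrightarrow> F w + \<sigma> * (g (dist v y) * dist w v)"
        by (intro tendsto_intros v)
      then have "\<forall>\<^sub>F n in sequentially. F w + \<sigma> * (g (dist (X n) y) * dist w (X n)) < F v"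
        using less by (rule order_tendstoD)
      then have "\<forall>\<^sub>F n in sequentially. w \<in> A (X n)"
        by (rule eventually_mono) (use w Fv in \<open>auto simp: A_def intro: less_imp_le less_le_trans\<close>)
      then have "\<forall>\<^sub>F n in sequentially. F v \<le> F w + 1 / real (Suc n)"
        by (rule eventually_mono) (use near_min Fv in \<open>blast intro: order_trans\<close>)
      moreover have "(\<lambda>n. F w + 1 / real (Suc n)) \<longlonglongrightarrow> F w + 0"
        by (intro tendsto_intros LIMSEQ_Suc[OF lim_1_over_n])
      ultimately have "F v \<le> F w + 0"
        by (intro tendsto_lowerbound) auto
      moreover have "0 \<le> \<sigma> * (g (dist v y) * dist w v)"
        using sigma g_pos[of "dist v y"] by simp
      ultimately show False using less by linarith
    qed
    then show ?thesis using F w vD by (simp add: g_def)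
  qed (simp add: D_def)
  ultimately show thesis by (rule that)
qed

section \<open>Application to the symmetrization framework\<close>

theorem theorem2p20:
  fixes i :: "'x::banach \<Rightarrow> 'v::banach" and j :: "'v \<Rightarrow> 'w::banach"
    and S :: "'x set" and \<H> :: "'h::topological_space set"
    and star :: "'x \<Rightarrow> 'x" and pol :: "'x \<Rightarrow> 'h \<Rightarrow> 'x" and \<Theta> :: "'x \<Rightarrow> 'x"
    and K C\<^sub>\<Theta> :: real
    and T :: "real \<Rightarrow> 'x \<Rightarrow> 'x"
    and h r :: "real \<Rightarrow> real"
    and f :: "'x \<Rightarrow> ereal"
    and u :: 'x and \<rho>\<^sub>0 \<rho> \<sigma> :: real
  assumes framework: "symmetrization_framework i j K S \<H> star pol \<Theta> C\<^sub>\<Theta>"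
    and T: "approximating_maps i S \<H> star pol T"
    and h_nonneg: "\<forall>s\<ge>0. h s \<ge> 0"
    and h_mono: "mono_on {0..} h"
    and h_cont: "continuous_on {0..} h"
    and h_int: "(\<integral>\<^sup>+ s\<in>{0..}. ennreal (1 / (1 + h s)) \<partial>lborel) = \<infinity>"
    and rho0_pos: "\<rho>\<^sub>0 > 0"
    and r_nonneg: "\<forall>t\<in>{0..<\<rho>\<^sub>0}. r t \<ge> 0"
    and r_int: "\<forall>t\<in>{0..<\<rho>\<^sub>0}. integral {0..r t} (\<lambda>s. 1 / (1 + h s)) \<ge> t"
    and r_lim: "(r \<longlongrightarrow> 0) (at_right 0)"
    and f_no_minf: "\<forall>x. f x \<noteq> -\<infinity>"
    and f_proper: "\<exists>x. f x \<noteq> \<infinity>"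
    and f_lsc: "lower_semicontinuous f"
    and f_bdd_below: "\<exists>m::real. \<forall>x. ereal m \<le> f x"
    and f_pol: "\<forall>z\<in>S. \<forall>H\<in>\<H>. f (pol z H) \<le> f z"
    and u: "u \<in> S"
    and rho: "\<rho> \<in> {0<..<\<rho>\<^sub>0}"
    and sigma: "\<sigma> > 0"
    and f_u: "f u < (INF x. f x) + ereal (\<sigma> * \<rho>)"
  shows "\<exists>v. norm (i v - i (star_ext \<Theta> star v)) < (K * (C\<^sub>\<Theta> + 1) + 1) * r \<rho>
           \<and> f v \<le> f u
           \<and> norm (v - u) \<le> r \<rho> + norm (T (r \<rho>) u - u)
           \<and> (\<forall>w. f w \<ge> f v - ereal (\<sigma> * (norm (w - v) / (1 + h (norm (v - T (r \<rho>) u))))))"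
proof -
  interpret symmetrization_framework i j K S \<H> star pol \<Theta> C\<^sub>\<Theta>
    by (rule framework)
  define R where "R = r \<rho>"
  have R0: "R \<ge> 0" and R_int: "integral {0..R} (\<lambda>s. 1 / (1 + h s)) \<ge> \<rho>"
    using rho r_nonneg r_int by (auto simp: R_def)
  \<comment> \<open>The maps \<open>T\<close> are controlled only at positive radii. At R = 0 the
    integral would vanish, although it is at least \<rho> > 0.\<close>
  have "R \<noteq> 0" using R_int rho by auto
  then obtain Hs where Hs: "set Hs \<subseteq> \<H>" "T R u = iterated_polarization pol u Hs"
    and close: "norm (i (T R u) - i (star u)) < R"
    using T u R0 unfolding approximating_maps_def by (metis order_le_less)
  have f_Tu: "f (T R u) \<le> f u"
    unfolding Hs(2) by (rule iterated_polarization_decreasing[OF pol_in f_pol u Hs(1)])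
  obtain m where m: "\<And>x. ereal m \<le> f x" using f_bdd_below by blast
  obtain v where v: "dist v (T R u) \<le> R" "f v \<le> f (T R u)"
    and min: "\<And>w. f w \<ge> f v - ereal (\<sigma> * (dist w v / (1 + h (dist v (T R u)))))"
    \<comment> \<open>Polarization does not raise \<open>f\<close>, so the base point
      \<open>T R u\<close> inherits the near-minimality of \<open>u\<close>.\<close>
    using Zhong_variational_principle[OF h_nonneg h_mono h_cont R0 R_int f_lsc m sigma
        le_less_trans[OF f_Tu f_u]] by blast
  have "norm (i v - i (star_ext \<Theta> star v)) < (K * (C\<^sub>\<Theta> + 1) + 1) * R"
    by (rule star_ext_approximation[OF u Hs(1)]) (use close v Hs(2) in \<open>auto simp: dist_norm\<close>)
  moreover have "f v \<le> f u" using v f_Tu by simp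
  moreover have "norm (v - u) \<le> R + norm (T R u - u)"
    using v dist_triangle[of v u "T R u"] by (simp add: dist_norm)
  ultimately show ?thesis
    using min unfolding R_def dist_norm by blast
qed

end
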